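(* Let $L=L_{\bar 0}\oplus L_{\bar 1}$ be a Lie superalgebra and let $c\ge 1$ be such that the set $S$ of commutators of length $c+1$ in $L$, $S=\{[x_1,x_2,\dots,x_{c+1}]: x_1,\dots,x_{c+1}\in L\}$, is finite. Then $L^{c+1}$ is finite dimensional. Further, if $L/Z_c(L)$ is generated by $(m\mid n)$ elements, then $$\dim L/Z_c(L)\le (m+n)^c\,\dim L^{c+1}.$$
   Context: All vector superspaces are over a field $\mathbb{F}$ of characteristic different from $2$ and $3$. A Lie superalgebra is a $\mathbb{Z}_2$-graded vector space $L=L_{\bar 0}\oplus L_{\bar 1}$ with a bilinear bracket satisfying, for homogeneous elements, $[L_\alpha,L_\beta]\subseteq L_{\alpha+\beta}$, $[x,y]=-(-1)^{|x||y|}[y,x]$, and $(-1)^{|x||z|}[x,[y,z]]+(-1)^{|y||x|}[y,[z,x]]+(-1)^{|z||y|}[z,[x,y]]=0$. Iterated commutators are left-normed: $[x_1,x_2,\dots,x_t]=[\cdots[[x_1,x_2],x_3],\cdots,x_t]$. The lower central series is $L^1=L$, $L^{k}=[L^{k-1},L]$ for $k\ge 2$ (the span of brackets). The upper central series is $Z_0(L)=\{0\}$, $Z_i(L)=\{x\in L: [x,y]\in Z_{i-1}(L)\ \forall y\in L\}$ for $i\ge 1$. "Generated by $(m\mid n)$ elements" means generated, as a Lie superalgebra, by $m$ even and $n$ odd elements. In the displayed inequality $\dim$ denotes the total vector space dimension (even plus odd). *)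

theory Defs
  imports
    "Jordan_Normal_Form.Missing_VectorSpace"
    "HOL-Algebra.AbelCoset"
    "HOL-Library.Z2"
begin

text \<open>
  A superalgebra over a field is a vector space record extended by a grading, indexed by the
  two-element field \<open>bit\<close> = Z/2Z (\<open>0\<close> even, \<open>1\<close> odd), and a bracket. The \<open>mult\<close> and \<open>one\<close> fields
  inherited from the HOL-Algebra \<open>module\<close> record play no role, as for every vector space
  represented this way.
\<close>

record ('a, 'b) superalgebra = "('a, 'b) module" +
  grade :: "bit \<Rightarrow> 'b set"
  lie :: "'b \<Rightarrow> 'b \<Rightarrow> 'b"

text \<open>The sign $(-1)^{\alpha\beta}$ as a scalar of \<open>K\<close>.\<close>

definition koszul_sign :: "('a, 'k) ring_scheme \<Rightarrow> bit \<Rightarrow> bit \<Rightarrow> 'a" where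
  "koszul_sign K \<alpha> \<beta> = (if \<alpha> * \<beta> = 1 then \<ominus>\<^bsub>K\<^esub> \<one>\<^bsub>K\<^esub> else \<one>\<^bsub>K\<^esub>)"

locale lie_superalgebra = vectorspace K L
  for K :: "('a, 'k) ring_scheme" and L :: "('a, 'b, 'l) superalgebra_scheme" +
  assumes grade_subspace: "VectorSpace.subspace K (grade L \<alpha>) L"
    and grade_sum: "carrier L = grade L 0 <+>\<^bsub>L\<^esub> grade L 1"
    and grade_disjoint: "grade L 0 \<inter> grade L 1 = {\<zero>\<^bsub>L\<^esub>}"
    and lie_closed:
      "\<lbrakk>x \<in> carrier L; y \<in> carrier L\<rbrakk> \<Longrightarrow> lie L x y \<in> carrier L"
    and lie_add_left:
      "\<lbrakk>x \<in> carrier L; y \<in> carrier L; z \<in> carrier L\<rbrakk>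
        \<Longrightarrow> lie L (x \<oplus>\<^bsub>L\<^esub> y) z = lie L x z \<oplus>\<^bsub>L\<^esub> lie L y z"
    and lie_add_right:
      "\<lbrakk>x \<in> carrier L; y \<in> carrier L; z \<in> carrier L\<rbrakk>
        \<Longrightarrow> lie L x (y \<oplus>\<^bsub>L\<^esub> z) = lie L x y \<oplus>\<^bsub>L\<^esub> lie L x z"
    and lie_smult_left:
      "\<lbrakk>a \<in> carrier K; x \<in> carrier L; y \<in> carrier L\<rbrakk>
        \<Longrightarrow> lie L (a \<odot>\<^bsub>L\<^esub> x) y = a \<odot>\<^bsub>L\<^esub> lie L x y"
    and lie_smult_right:
      "\<lbrakk>a \<in> carrier K; x \<in> carrier L; y \<in> carrier L\<rbrakk>
        \<Longrightarrow> lie L x (a \<odot>\<^bsub>L\<^esub> y) = a \<odot>\<^bsub>L\<^esub> lie L x y"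
    and lie_grade:
      "\<lbrakk>x \<in> grade L \<alpha>; y \<in> grade L \<beta>\<rbrakk> \<Longrightarrow> lie L x y \<in> grade L (\<alpha> + \<beta>)"
    and super_skew:
      "\<lbrakk>x \<in> grade L \<alpha>; y \<in> grade L \<beta>\<rbrakk>
        \<Longrightarrow> lie L x y = \<ominus>\<^bsub>L\<^esub> (koszul_sign K \<alpha> \<beta> \<odot>\<^bsub>L\<^esub> lie L y x)"
    and super_jacobi:
      "\<lbrakk>x \<in> grade L \<alpha>; y \<in> grade L \<beta>; z \<in> grade L \<gamma>\<rbrakk>
        \<Longrightarrow> koszul_sign K \<alpha> \<gamma> \<odot>\<^bsub>L\<^esub> lie L x (lie L y z)
          \<oplus>\<^bsub>L\<^esub> koszul_sign K \<beta> \<alpha> \<odot>\<^bsub>L\<^esub> lie L y (lie L z x)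
          \<oplus>\<^bsub>L\<^esub> koszul_sign K \<gamma> \<beta> \<odot>\<^bsub>L\<^esub> lie L z (lie L x y) = \<zero>\<^bsub>L\<^esub>"

definition commutators :: "('a, 'b, 'l) superalgebra_scheme \<Rightarrow> nat \<Rightarrow> 'b set" where
  "commutators L t =
     {foldl (lie L) x xs | x xs. x \<in> carrier L \<and> set xs \<subseteq> carrier L \<and> Suc (length xs) = t}"

text \<open>
  The lower central series is numbered from \<open>1\<close>; the value at \<open>0\<close> is a dummy.
  The span is qualified because HOL also has a type-class based \<open>module.span\<close>.
\<close>

fun lower_central ::
  "('a, 'k) ring_scheme \<Rightarrow> ('a, 'b, 'l) superalgebra_scheme \<Rightarrow> nat \<Rightarrow> 'b set" where
  "lower_central K L 0 = carrier L"
| "lower_central K L (Suc 0) = carrier L"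
| "lower_central K L (Suc (Suc k)) =
     LinearCombinations.module.span K L
       {lie L x y | x y. x \<in> lower_central K L (Suc k) \<and> y \<in> carrier L}"

primrec upper_central :: "('a, 'b, 'l) superalgebra_scheme \<Rightarrow> nat \<Rightarrow> 'b set" where
  "upper_central L 0 = {\<zero>\<^bsub>L\<^esub>}"
| "upper_central L (Suc i) =
     {x \<in> carrier L. \<forall>y\<in>carrier L. lie L x y \<in> upper_central L i}"

text \<open>
  The quotient by a graded ideal \<open>I\<close>, on the cosets of \<open>I\<close>. As for the multiplication of
  \<open>FactRing\<close>, scalar multiplication and bracket are unions over all representatives; for an
  ideal \<open>I\<close> these collapse to the coset of \<open>a x\<close> and of \<open>[x, y]\<close>.
\<close>

definition quotient_superalgebra ::
  "('a, 'b, 'l) superalgebra_scheme \<Rightarrow> 'b set \<Rightarrow> ('a, 'b set) superalgebra" where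
  "quotient_superalgebra L I =
     \<lparr>carrier = a_rcosets\<^bsub>L\<^esub> I, mult = undefined, one = undefined,
      zero = I, add = (<+>\<^bsub>L\<^esub>),
      smult = (\<lambda>a A. \<Union>x\<in>A. I +>\<^bsub>L\<^esub> (a \<odot>\<^bsub>L\<^esub> x)),
      grade = (\<lambda>\<alpha>. {I +>\<^bsub>L\<^esub> x | x. x \<in> grade L \<alpha>}),
      lie = (\<lambda>A B. \<Union>x\<in>A. \<Union>y\<in>B. I +>\<^bsub>L\<^esub> lie L x y)\<rparr>"

definition lie_subsuperalgebra ::
  "('a, 'k) ring_scheme \<Rightarrow> 'b set \<Rightarrow> ('a, 'b, 'l) superalgebra_scheme \<Rightarrow> bool" where
  "lie_subsuperalgebra K H L \<longleftrightarrow>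
     VectorSpace.subspace K H L \<and>
     H = (H \<inter> grade L 0) <+>\<^bsub>L\<^esub> (H \<inter> grade L 1) \<and>
     (\<forall>x\<in>H. \<forall>y\<in>H. lie L x y \<in> H)"

definition generated_subsuperalgebra ::
  "('a, 'k) ring_scheme \<Rightarrow> ('a, 'b, 'l) superalgebra_scheme \<Rightarrow> 'b set \<Rightarrow> 'b set" where
  "generated_subsuperalgebra K L X = \<Inter>{H. lie_subsuperalgebra K H L \<and> X \<subseteq> H}"

text \<open>Generation by \<open>m\<close> even and \<open>n\<close> odd elements; the generators are tuples, so repetitions
  are allowed.\<close>

definition generated_by ::
  "('a, 'k) ring_scheme \<Rightarrow> ('a, 'b, 'l) superalgebra_scheme \<Rightarrow> nat \<Rightarrow> nat \<Rightarrow> bool" where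
  "generated_by K L m n \<longleftrightarrow>
     (\<exists>xs ys. length xs = m \<and> length ys = n \<and> set xs \<subseteq> grade L 0 \<and> set ys \<subseteq> grade L 1 \<and>
        generated_subsuperalgebra K L (set xs \<union> set ys) = carrier L)"

end

theory Submission
  imports Defs
begin

text \<open>
  The space $L^{c+1}$ is spanned by the commutators of length $c+1$. For the bound, lift the given
  generators of $L/Z_c(L)$ to a set $A$ of at most $m+n$ homogeneous elements of $L$. Each of the at
  most $(m+n)^c$ words $a_1, \dots, a_c$ over $A$ gives a linear map
  $x \mapsto [x, a_1, \dots, a_c]$ from $L$ to $L^{c+1}$, and it suffices that the joint kernel is
  contained in $Z_c(L)$. For $x$ homogeneous in the joint kernel one shows by induction on $j$ that
  $[x, a_1, \dots, a_{c-j}]$ lies in $Z_j(L)$ for all words. In the step from $j$ to $j+1$ let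
  $y = [x, a_1, \dots, a_{c-j-1}]$; the elements $z$ with $[y, z] \in Z_j(L)$ form a graded
  subalgebra, which contains $A$ by the induction hypothesis, and contains $Z_c(L)$ because a
  commutator of $k$ elements maps $Z_i(L)$ to $Z_{i-k}(L)$; so it is $L$, that is,
  $y \in Z_{j+1}(L)$.
\<close>

section \<open>Dimension counting with linear maps\<close>

lemma (in module) submodule_neg:
  assumes "submodule R N M" "v \<in> N"
  shows "\<ominus>\<^bsub>M\<^esub> v \<in> N"
proof -
  have "v \<in> carrier M" using assms submodule.subset by blast
  then have "\<ominus>\<^bsub>M\<^esub> v = (\<ominus>\<^bsub>R\<^esub> \<one>\<^bsub>R\<^esub>) \<odot>\<^bsub>M\<^esub> v"
    by (simp add: smult_l_minus)
  then show ?thesis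
    using assms submodule.smult_closed[OF assms(1)] by simp
qed

lemma (in module) submodule_diff:
  assumes "submodule R N M" "v \<in> N" "w \<in> N"
  shows "v \<ominus>\<^bsub>M\<^esub> w \<in> N"
  using assms submodule_neg submodule.m_closed[OF assms(1)] by (simp add: a_minus_def)

lemma (in module) submodule_addD:
  assumes "submodule R N M" "x \<in> carrier M" "y \<in> N" "x \<oplus>\<^bsub>M\<^esub> y \<in> N"
  shows "x \<in> N"
proof -
  have y: "y \<in> carrier M" using assms submodule.subset by blast
  have "x \<oplus>\<^bsub>M\<^esub> y \<ominus>\<^bsub>M\<^esub> y \<in> N" using assms submodule_diff by blast
  also have "x \<oplus>\<^bsub>M\<^esub> y \<ominus>\<^bsub>M\<^esub> y = x"
    using assms(2) y by (simp add: a_minus_def M.a_assoc M.r_neg)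
  finally show ?thesis .
qed

lemma (in module) submodule_closedI:
  assumes "N \<subseteq> carrier M" "\<zero>\<^bsub>M\<^esub> \<in> N"
    and "\<And>v w. v \<in> N \<Longrightarrow> w \<in> N \<Longrightarrow> v \<oplus>\<^bsub>M\<^esub> w \<in> N"
    and "\<And>a v. a \<in> carrier R \<Longrightarrow> v \<in> N \<Longrightarrow> a \<odot>\<^bsub>M\<^esub> v \<in> N"
  shows "submodule R N M"
  using assms module_axioms by (intro submodule.intro) auto

lemma (in mod_hom) image_submodule:
  assumes "submodule R U M"
  shows "submodule R (f ` U) N"
proof (rule N.submodule_closedI)
  note U = submodule.subset[OF assms]
  show "f ` U \<subseteq> carrier N" using U by auto
  show "\<zero>\<^bsub>N\<^esub> \<in> f ` U" using submodule.zero_closed[OF assms] f0_is_0 by (metis imageI)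
  fix v w assume "v \<in> f ` U" "w \<in> f ` U"
  then obtain x y where xy: "x \<in> U" "y \<in> U" "v = f x" "w = f y" by auto
  then have "v \<oplus>\<^bsub>N\<^esub> w = f (x \<oplus>\<^bsub>M\<^esub> y)" using U by (simp add: subset_iff)
  then show "v \<oplus>\<^bsub>N\<^esub> w \<in> f ` U" using xy submodule.m_closed[OF assms] by auto
next
  note U = submodule.subset[OF assms]
  fix a v assume a: "a \<in> carrier R" "v \<in> f ` U"
  then obtain x where x: "x \<in> U" "v = f x" by auto
  then have "a \<odot>\<^bsub>N\<^esub> v = f (a \<odot>\<^bsub>M\<^esub> x)" using U a by (simp add: subset_iff)
  then show "a \<odot>\<^bsub>N\<^esub> v \<in> f ` U" using x a submodule.smult_closed[OF assms] by auto
qed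

lemma (in mod_hom) span_image_subset:
  assumes "A \<subseteq> carrier M"
  shows "N.span (f ` A) \<subseteq> f ` M.span A"
proof (rule N.span_is_subset)
  show "f ` A \<subseteq> f ` M.span A" using M.in_own_span[OF assms] by auto
  show "submodule R (f ` M.span A) N" by (intro image_submodule M.span_is_submodule assms)
qed

lemma (in mod_hom) image_span_subset:
  assumes "A \<subseteq> carrier M"
  shows "f ` M.span A \<subseteq> N.span (f ` A)"
proof -
  have fA: "f ` A \<subseteq> carrier N" using assms by auto
  note S = N.span_is_submodule[OF fA]
  let ?U = "{v \<in> carrier M. f v \<in> N.span (f ` A)}"
  have "submodule R ?U M"
    using submodule.zero_closed[OF S] submodule.m_closed[OF S] submodule.smult_closed[OF S]
    by (intro M.submodule_closedI) (simp_all add: subset_iff)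
  moreover have "A \<subseteq> ?U" using assms N.in_own_span[OF fA] by blast
  ultimately show ?thesis using M.span_is_subset by blast
qed

text \<open>The vectors are preimages of a basis of the image of \<open>T\<close>. As
  \<open>V\<close> may be infinite dimensional, the rank bound takes the form that at most
  \<open>W.dim\<close> vectors span \<open>V\<close> modulo the kernel of \<open>T\<close>.\<close>

lemma (in linear_map) carrier_eq_span_plus_ker:
  assumes "W.fin_dim"
  shows "\<exists>A. finite A \<and> A \<subseteq> carrier V \<and> card A \<le> W.dim \<and>
    (\<forall>v\<in>carrier V. \<exists>s\<in>V.module.span A. T v = T s)"
proof -
  let ?P = "\<lambda>B. B \<subseteq> T ` carrier V \<and> W.module.lin_indpt B"
  have TW: "T ` carrier V \<subseteq> carrier W" by auto
  have 0: "?P {}" using W.module.finite_lin_indpt2[of "{}"] by auto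
  have 1: "finite B \<and> card B \<le> W.dim" if "?P B" for B
    using W.li_le_dim[OF assms, of B] that TW by blast
  \<comment> \<open>The bound \<open>W.dim\<close> on the size of independent subsets of the image
    yields a maximal one, which then spans the image.\<close>
  obtain B where B: "finite B" "maximal B ?P"
    using maximal_exists[of ?P, OF 1 0] by metis
  then have PB: "?P B" by (simp add: maximal_def)
  have gen: "T ` carrier V \<subseteq> W.module.span B"
  proof
    fix w assume w: "w \<in> T ` carrier V"
    show "w \<in> W.module.span B"
    proof (cases "w \<in> B")
      case True
      then show ?thesis using W.module.in_own_span[of B] PB TW by blast
    next
      case False
      have "\<not> ?P (B \<union> {w})" using B False unfolding maximal_def by blast
      then show ?thesis using W.lin_dep_iff_in_span[of B w] PB w False TW by auto
    qed
  qed
  define A where "A = inv_into (carrier V) T ` B"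
  have AV: "A \<subseteq> carrier V" using PB by (auto simp: A_def inv_into_into)
  have TA: "T ` A = B" using PB by (force simp: A_def image_image f_inv_into_f)
  have "card B \<le> W.dim" using 1[OF PB] by simp
  then have "finite A" "card A \<le> W.dim"
    using B(1) card_image_le[OF B(1), of "inv_into (carrier V) T"] by (auto simp: A_def)
  moreover have "\<exists>s\<in>V.module.span A. T v = T s" if v: "v \<in> carrier V" for v
    using gen span_image_subset[OF AV] TA v by blast
  ultimately show ?thesis using AV by blast
qed

text \<open>Induction on \<open>F\<close>: each further map, restricted to the joint kernel of the
  earlier ones, costs at most dim \<open>W\<close> more vectors. In effect, \<open>V\<close> modulo
  the joint kernel has dimension at most \<open>card F\<close> times dim \<open>W\<close>, without
  any finiteness of \<open>V\<close>.\<close>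

lemma (in vectorspace) carrier_eq_span_plus_joint_ker:
  assumes W: "vectorspace K W" "vectorspace.fin_dim K W"
    and "finite F" "F \<subseteq> module_hom K V W"
  shows "\<exists>A. finite A \<and> A \<subseteq> carrier V \<and> card A \<le> card F * vectorspace.dim K W \<and>
    (\<forall>v\<in>carrier V. \<exists>s\<in>span A. \<forall>f\<in>F. f (v \<ominus>\<^bsub>V\<^esub> s) = \<zero>\<^bsub>W\<^esub>)"
  using assms(3,4)
proof (induction F)
  case empty
  show ?case by (rule exI[of _ "{}"]) (use span_zero in auto)
next
  case (insert f F)
  interpret W: vectorspace K W by (rule W(1))
  obtain A where A: "finite A" "A \<subseteq> carrier V" "card A \<le> card F * W.dim"
    "\<And>v. v \<in> carrier V \<Longrightarrow> \<exists>s\<in>span A. \<forall>f\<in>F. f (v \<ominus>\<^bsub>V\<^esub> s) = \<zero>\<^bsub>W\<^esub>"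
    using insert by auto
  have hom: "linear_map K V W g" if "g \<in> insert f F" for g
    using that insert.prems
    by (intro linear_map.intro mod_hom.intro mod_hom_axioms.intro vectorspace_axioms W(1)
        module_axioms W.module_axioms) auto
  have add: "g (v \<oplus>\<^bsub>V\<^esub> w) = g v \<oplus>\<^bsub>W\<^esub> g w"
    if "g \<in> insert f F" "v \<in> carrier V" "w \<in> carrier V" for g v w
    using linear_map.T_add[OF hom[OF that(1)] that(2,3)] .
  have smult: "g (a \<odot>\<^bsub>V\<^esub> v) = a \<odot>\<^bsub>W\<^esub> g v"
    if "g \<in> insert f F" "a \<in> carrier K" "v \<in> carrier V" for g a v
    using linear_map.T_smult[OF hom[OF that(1)] that(2,3)] .
  have zero: "g \<zero>\<^bsub>V\<^esub> = \<zero>\<^bsub>W\<^esub>" if "g \<in> insert f F" for g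
    using linear_map.T0_is_0[OF hom[OF that]] .
  define U where "U = {v \<in> carrier V. \<forall>g\<in>F. g v = \<zero>\<^bsub>W\<^esub>}"
  have U: "submodule K U V"
  proof (rule submodule_closedI)
    fix v w assume vw: "v \<in> U" "w \<in> U"
    have "g (v \<oplus>\<^bsub>V\<^esub> w) = \<zero>\<^bsub>W\<^esub>" if "g \<in> F" for g
    proof -
      have "g v = \<zero>\<^bsub>W\<^esub>" "g w = \<zero>\<^bsub>W\<^esub>" "v \<in> carrier V" "w \<in> carrier V"
        using vw that unfolding U_def by blast+
      then show ?thesis using that by (simp add: add)
    qed
    then show "v \<oplus>\<^bsub>V\<^esub> w \<in> U" using vw unfolding U_def by blast
  next
    fix a v assume av: "a \<in> carrier K" "v \<in> U"
    have "g (a \<odot>\<^bsub>V\<^esub> v) = \<zero>\<^bsub>W\<^esub>" if "g \<in> F" for g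
    proof -
      have "g v = \<zero>\<^bsub>W\<^esub>" "v \<in> carrier V" using av that unfolding U_def by blast+
      then show ?thesis using that av by (simp add: smult)
    qed
    then show "a \<odot>\<^bsub>V\<^esub> v \<in> U" using av unfolding U_def by blast
  qed (use zero in \<open>auto simp: U_def\<close>)
  have UV: "U \<subseteq> carrier V" by (auto simp: U_def)
  have sU: "subspace K U V" using U vectorspace_axioms by (simp add: subspace_def)
  interpret f: linear_map K V W f using hom by auto
  interpret U: vectorspace K "vs U" by (rule subspace_is_vs[OF sU])
  have "f \<in> module_hom K (vs U) W"
    using UV f.T_hom by (simp add: module_hom_def subset_iff Pi_iff)
  then interpret fU: linear_map K "vs U" W f
    by (intro linear_map.intro mod_hom.intro mod_hom_axioms.intro U.vectorspace_axioms W(1)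
        U.module_axioms W.module_axioms)
  \<comment> \<open>The one-map case is applied to \<open>f\<close> on \<open>U\<close>. Hence
    \<open>B\<close> lies in the joint kernel of the earlier maps, and a correction by
    \<open>span B\<close>, made to kill \<open>f\<close>, does not disturb what
    \<open>span A\<close> has already achieved for \<open>F\<close>.\<close>
  obtain B where B: "finite B" "B \<subseteq> U" "card B \<le> W.dim"
    and B': "\<And>v. v \<in> U \<Longrightarrow> \<exists>s\<in>U.module.span B. f v = f s"
    using fU.carrier_eq_span_plus_ker[OF W(2)] by auto
  have spB: "U.module.span B = span B" using span_li_not_depend[OF B(2) U] by simp
  have BV: "B \<subseteq> carrier V" using B UV by auto
  have BU: "span B \<subseteq> U" using span_is_subset[OF B(2) U] .
  have "\<exists>s\<in>span (A \<union> B). \<forall>g\<in>insert f F. g (v \<ominus>\<^bsub>V\<^esub> s) = \<zero>\<^bsub>W\<^esub>" if v: "v \<in> carrier V" for v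
  proof -
    obtain s where s: "s \<in> span A" "\<And>g. g \<in> F \<Longrightarrow> g (v \<ominus>\<^bsub>V\<^esub> s) = \<zero>\<^bsub>W\<^esub>" using A(4)[OF v] by auto
    have sV: "s \<in> carrier V" using s span_closed[OF A(2)] by simp
    have vs: "v \<ominus>\<^bsub>V\<^esub> s \<in> U" using s sV v by (simp add: U_def)
    obtain t where t: "t \<in> span B" "f (v \<ominus>\<^bsub>V\<^esub> s) = f t" using B'[OF vs] spB by auto
    have tU: "t \<in> U" using t BU by auto
    then have tV: "t \<in> carrier V" using UV by auto
    have ft: "f (v \<ominus>\<^bsub>V\<^esub> s \<ominus>\<^bsub>V\<^esub> t) = \<zero>\<^bsub>W\<^esub>"
      using f.f_minus[OF M.minus_closed[OF v sV] tV] t f.T_im[OF tV]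
      by (simp add: a_minus_def W.M.r_neg)
    have eq: "v \<ominus>\<^bsub>V\<^esub> (s \<oplus>\<^bsub>V\<^esub> t) = v \<ominus>\<^bsub>V\<^esub> s \<ominus>\<^bsub>V\<^esub> t"
      using v sV tV by (simp add: a_minus_def M.minus_add M.a_assoc)
    have "v \<ominus>\<^bsub>V\<^esub> s \<ominus>\<^bsub>V\<^esub> t \<in> U" using submodule_diff[OF U vs tU] .
    then have "\<forall>g\<in>insert f F. g (v \<ominus>\<^bsub>V\<^esub> (s \<oplus>\<^bsub>V\<^esub> t)) = \<zero>\<^bsub>W\<^esub>"
      unfolding eq using ft by (auto simp: U_def)
    moreover have "s \<oplus>\<^bsub>V\<^esub> t \<in> span (A \<union> B)"
      using span_add1[of "A \<union> B" s t] s(1) t(1) A(2) BV span_is_monotone[of A "A \<union> B"]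
        span_is_monotone[of B "A \<union> B"] by blast
    ultimately show ?thesis by blast
  qed
  moreover have "card (A \<union> B) \<le> card (insert f F) * W.dim"
    using card_Un_le[of A B] A(3) B(3) insert.hyps by simp
  ultimately show ?case using A B BV by (intro exI[of _ "A \<union> B"]) auto
qed

section \<open>Cosets of submodules and finitely spanned subspaces\<close>

lemma (in module) abelian_subgroup_submodule:
  assumes "submodule R N M"
  shows "abelian_subgroup N M"
proof (rule abelian_subgroupI3)
  have "subgroup N (add_monoid M)"
    using submodule.subset[OF assms] submodule.m_closed[OF assms] submodule.zero_closed[OF assms]
      submodule_neg[OF assms]
    by (intro subgroup.intro) (auto simp: a_inv_def[symmetric])
  then show "additive_subgroup N M" by (rule additive_subgroup.intro)
  show "abelian_group M" by (rule M.abelian_group_axioms)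
qed

lemma (in module) a_r_coset_eq_iff:
  assumes N: "submodule R N M" and "x \<in> carrier M" "y \<in> carrier M"
  shows "N +>\<^bsub>M\<^esub> x = N +>\<^bsub>M\<^esub> y \<longleftrightarrow> x \<ominus>\<^bsub>M\<^esub> y \<in> N"
proof -
  interpret N: abelian_subgroup N M by (rule abelian_subgroup_submodule[OF N])
  have "N +>\<^bsub>M\<^esub> x = N +>\<^bsub>M\<^esub> y \<longleftrightarrow> x \<in> N +>\<^bsub>M\<^esub> y"
    using assms(2,3) N.a_rcos_self[of x] N.a_repr_independence'[of x y] by auto
  also have "\<dots> \<longleftrightarrow> x \<ominus>\<^bsub>M\<^esub> y \<in> N"
    using N.a_rcos_module[OF assms(3,2)] by (simp add: a_minus_def)
  finally show ?thesis .
qed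

lemma (in vectorspace) fin_dim_span:
  assumes "finite S" "S \<subseteq> carrier V"
  shows "vectorspace.fin_dim K (vs (span S))"
proof -
  interpret S: vectorspace K "vs (span S)"
    using span_is_subspace[OF assms(2)] by (rule subspace_is_vs)
  have "S.span S = span S"
    using span_li_not_depend[OF in_own_span[OF assms(2)] span_is_submodule[OF assms(2)]] by simp
  then show ?thesis
    unfolding S.fin_dim_def using assms in_own_span[OF assms(2)] by auto
qed

section \<open>Graded subspaces and the upper central series\<close>

text \<open>In a Lie superalgebra this is equivalent to \<open>N\<close> being the sum of its
  intersections with the two grades. The form with components is the one that transfers directly to
  centralizers and to the upper central series.\<close>

definition graded_subspace ::
  "('a, 'k) ring_scheme \<Rightarrow> ('a, 'b, 'l) superalgebra_scheme \<Rightarrow> 'b set \<Rightarrow> bool" where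
  "graded_subspace K L N \<longleftrightarrow> submodule K N L \<and>
     (\<forall>x\<in>grade L 0. \<forall>y\<in>grade L 1. x \<oplus>\<^bsub>L\<^esub> y \<in> N \<longrightarrow> x \<in> N \<and> y \<in> N)"

context lie_superalgebra
begin

section \<open>Signs, skew symmetry and the Jacobi identity as membership rules\<close>

lemma grade_submodule: "submodule K (grade L \<alpha>) L"
  using grade_subspace is_module by blast

lemma grade_carrier: "x \<in> grade L \<alpha> \<Longrightarrow> x \<in> carrier L"
  using submodule.subset[OF grade_submodule] by blast

lemma homogeneous_components:
  assumes "x \<in> carrier L"
  obtains x0 x1 where "x0 \<in> grade L 0" "x1 \<in> grade L 1" "x = x0 \<oplus>\<^bsub>L\<^esub> x1"
  using assms grade_sum by (auto simp: set_add_def')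

lemma lie_zero_left: "x \<in> carrier L \<Longrightarrow> lie L \<zero>\<^bsub>L\<^esub> x = \<zero>\<^bsub>L\<^esub>"
  using lie_smult_left[of "\<zero>\<^bsub>K\<^esub>" "\<zero>\<^bsub>L\<^esub>" x] lie_closed[of "\<zero>\<^bsub>L\<^esub>" x] by simp

lemma lie_zero_right: "x \<in> carrier L \<Longrightarrow> lie L x \<zero>\<^bsub>L\<^esub> = \<zero>\<^bsub>L\<^esub>"
  using lie_smult_right[of "\<zero>\<^bsub>K\<^esub>" x "\<zero>\<^bsub>L\<^esub>"] lie_closed[of x "\<zero>\<^bsub>L\<^esub>"] by simp

lemma koszul_sign_carrier: "koszul_sign K \<alpha> \<beta> \<in> carrier K"
  by (simp add: koszul_sign_def)

lemma koszul_sign_smult_cancel: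
  assumes "x \<in> carrier L"
  shows "koszul_sign K \<alpha> \<beta> \<odot>\<^bsub>L\<^esub> (koszul_sign K \<alpha> \<beta> \<odot>\<^bsub>L\<^esub> x) = x"
  using assms by (simp add: koszul_sign_def smult_l_minus)

text \<open>A sign is its own inverse, so membership in a submodule does not see it. This removes
  the signs from all later uses of skew symmetry and the Jacobi identity.\<close>

lemma koszul_sign_smult_mem:
  assumes "submodule K N L" "x \<in> carrier L"
  shows "koszul_sign K \<alpha> \<beta> \<odot>\<^bsub>L\<^esub> x \<in> N \<longleftrightarrow> x \<in> N"
  using submodule.smult_closed[OF assms(1) koszul_sign_carrier]
    koszul_sign_smult_cancel[OF assms(2)] by metis

lemma lie_swap_mem_homogeneous:
  assumes "submodule K N L" "x \<in> grade L \<alpha>" "y \<in> grade L \<beta>" "lie L x y \<in> N"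
  shows "lie L y x \<in> N"
  unfolding super_skew[OF assms(3,2)]
  using assms submodule_neg[OF assms(1)] by (auto simp: koszul_sign_smult_mem lie_closed grade_carrier)

text \<open>Two of the three terms of the Jacobi identity lie in \<open>N\<close> and the sum is
  zero, so the third lies in \<open>N\<close> as well.\<close>

lemma lie_jacobi_mem:
  assumes "submodule K N L" "x \<in> grade L \<alpha>" "y \<in> grade L \<beta>" "z \<in> grade L \<gamma>"
    and "lie L y (lie L z x) \<in> N" "lie L z (lie L x y) \<in> N"
  shows "lie L x (lie L y z) \<in> N"
proof -
  note c = assms(2-4)[THEN grade_carrier]
  let ?k = "\<lambda>\<alpha> \<beta> u. koszul_sign K \<alpha> \<beta> \<odot>\<^bsub>L\<^esub> u"
  let ?a = "?k \<alpha> \<gamma> (lie L x (lie L y z))"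
  let ?b = "?k \<beta> \<alpha> (lie L y (lie L z x))" and ?c = "?k \<gamma> \<beta> (lie L z (lie L x y))"
  have mem: "?b \<in> N" "?c \<in> N"
    using assms(1,5,6) c by (simp_all add: koszul_sign_smult_mem lie_closed)
  have cl: "?a \<in> carrier L" "?b \<in> carrier L" "?c \<in> carrier L"
    using c by (auto intro!: smult_closed koszul_sign_carrier lie_closed)
  have "?a \<oplus>\<^bsub>L\<^esub> (?b \<oplus>\<^bsub>L\<^esub> ?c) = \<zero>\<^bsub>L\<^esub>"
    using super_jacobi[OF assms(2-4)] cl by (simp add: M.a_assoc)
  then have "?a \<in> N"
    using submodule_addD[OF assms(1) cl(1), of "?b \<oplus>\<^bsub>L\<^esub> ?c"] mem
      submodule.m_closed[OF assms(1)] submodule.zero_closed[OF assms(1)] by simp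
  then show ?thesis
    using assms(1) c by (simp add: koszul_sign_smult_mem lie_closed)
qed

section \<open>Graded subspaces and centralizers\<close>

lemma graded_subspace_submodule: "graded_subspace K L N \<Longrightarrow> submodule K N L"
  by (simp add: graded_subspace_def)

text \<open>This form allows either order of the parities. It is what is needed after bracketing
  with a homogeneous element, which shifts both degrees by the same amount.\<close>

lemma graded_subspace_components:
  assumes N: "graded_subspace K L N" and "x \<in> grade L \<alpha>" "y \<in> grade L (\<alpha> + 1)" "x \<oplus>\<^bsub>L\<^esub> y \<in> N"
  shows "x \<in> N" "y \<in> N"
proof -
  have "x \<in> N \<and> y \<in> N"
  proof (cases \<alpha>)
    case zero
    then show ?thesis using assms by (simp add: graded_subspace_def)
  next
    case one
    have "y \<oplus>\<^bsub>L\<^esub> x = x \<oplus>\<^bsub>L\<^esub> y" using assms grade_carrier M.a_comm by blast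
    then show ?thesis using one assms by (simp add: graded_subspace_def)
  qed
  then show "x \<in> N" "y \<in> N" by auto
qed

lemma graded_subspace_obtain:
  assumes "graded_subspace K L N" "x \<in> N"
  obtains x0 x1 where "x0 \<in> grade L 0" "x0 \<in> N" "x1 \<in> grade L 1" "x1 \<in> N" "x = x0 \<oplus>\<^bsub>L\<^esub> x1"
proof -
  have "x \<in> carrier L" using assms graded_subspace_submodule submodule.subset by blast
  then obtain x0 x1 where "x0 \<in> grade L 0" "x1 \<in> grade L 1" "x = x0 \<oplus>\<^bsub>L\<^esub> x1"
    by (rule homogeneous_components)
  then show ?thesis using that assms by (auto simp: graded_subspace_def)
qed

text \<open>Skew symmetry and the Jacobi identity speak of homogeneous elements only. Since the
  components of \<open>x\<close> and \<open>y\<close> stay in \<open>U\<close> and \<open>W\<close>,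
  expanding the bracket reduces a membership claim to that case.\<close>

lemma bilinear_mem_of_homogeneous:
  assumes N: "submodule K N L" and U: "graded_subspace K L U" and W: "graded_subspace K L W"
    and hom: "\<And>\<alpha> \<beta> x y. x \<in> grade L \<alpha> \<Longrightarrow> x \<in> U \<Longrightarrow> y \<in> grade L \<beta> \<Longrightarrow> y \<in> W \<Longrightarrow> lie L x y \<in> N"
    and "x \<in> U" "y \<in> W"
  shows "lie L x y \<in> N"
proof -
  obtain x0 x1 where x: "x0 \<in> grade L 0" "x0 \<in> U" "x1 \<in> grade L 1" "x1 \<in> U" "x = x0 \<oplus>\<^bsub>L\<^esub> x1"
    using graded_subspace_obtain[OF U \<open>x \<in> U\<close>] .
  obtain y0 y1 where y: "y0 \<in> grade L 0" "y0 \<in> W" "y1 \<in> grade L 1" "y1 \<in> W" "y = y0 \<oplus>\<^bsub>L\<^esub> y1"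
    using graded_subspace_obtain[OF W \<open>y \<in> W\<close>] .
  have "lie L x y = lie L x0 y0 \<oplus>\<^bsub>L\<^esub> lie L x1 y0 \<oplus>\<^bsub>L\<^esub> (lie L x0 y1 \<oplus>\<^bsub>L\<^esub> lie L x1 y1)"
    using x y by (simp add: grade_carrier lie_add_left lie_add_right lie_closed)
  also have "\<dots> \<in> N"
    by (intro submodule.m_closed[OF N] hom[OF x(1,2) y(1,2)] hom[OF x(1,2) y(3,4)]
        hom[OF x(3,4) y(1,2)] hom[OF x(3,4) y(3,4)])
  finally show ?thesis .
qed

lemma graded_subspace_carrier: "graded_subspace K L (carrier L)"
proof -
  have "submodule K (carrier L) L" by (rule submodule_closedI) auto
  then show ?thesis using grade_carrier unfolding graded_subspace_def by blast
qed

lemma lie_swap_mem: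
  assumes N: "submodule K N L" and U: "graded_subspace K L U" and W: "graded_subspace K L W"
    and "\<And>x y. x \<in> U \<Longrightarrow> y \<in> W \<Longrightarrow> lie L x y \<in> N" and "x \<in> U" "y \<in> W"
  shows "lie L y x \<in> N"
proof (rule bilinear_mem_of_homogeneous[OF N W U _ assms(6,5)])
  fix \<alpha> \<beta> y x
  assume "y \<in> grade L \<alpha>" "y \<in> W" "x \<in> grade L \<beta>" "x \<in> U"
  then show "lie L y x \<in> N"
    by (intro lie_swap_mem_homogeneous[OF N, of x \<beta> y \<alpha>] assms(4))
qed

text \<open>Because \<open>y\<close> is homogeneous, bracketing with it maps the components of an
  element to the components of the result, and these lie in \<open>N\<close> separately.\<close>

lemma graded_subspace_centralizer:
  assumes N: "graded_subspace K L N" and y: "y \<in> grade L \<alpha>"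
  shows "graded_subspace K L {z \<in> carrier L. lie L y z \<in> N}"
proof -
  note yc = grade_carrier[OF y] and s = graded_subspace_submodule[OF N]
  have "x0 \<in> carrier L \<and> lie L y x0 \<in> N \<and> x1 \<in> carrier L \<and> lie L y x1 \<in> N"
    if x: "x0 \<in> grade L 0" "x1 \<in> grade L 1" "lie L y (x0 \<oplus>\<^bsub>L\<^esub> x1) \<in> N" for x0 x1
  proof -
    have c: "x0 \<in> carrier L" "x1 \<in> carrier L" using x grade_carrier by auto
    have "lie L y x0 \<oplus>\<^bsub>L\<^esub> lie L y x1 \<in> N" using x c yc by (simp add: lie_add_right)
    moreover have "lie L y x0 \<in> grade L \<alpha>" "lie L y x1 \<in> grade L (\<alpha> + 1)"
      using lie_grade[OF y x(1), unfolded add_0_right] lie_grade[OF y x(2)] .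
    ultimately show ?thesis using graded_subspace_components[OF N] c by blast
  qed
  moreover have "submodule K {z \<in> carrier L. lie L y z \<in> N} L"
    using yc submodule.zero_closed[OF s] submodule.m_closed[OF s] submodule.smult_closed[OF s]
    by (intro submodule_closedI) (auto simp: lie_zero_right lie_add_right lie_smult_right)
  ultimately show ?thesis by (auto simp: graded_subspace_def)
qed

text \<open>For homogeneous \<open>z\<close> and \<open>w\<close> the Jacobi identity expresses
  [y,[z,w]] by [z,[w,y]] and [w,[y,z]]. Both inner brackets are in \<open>N\<close>, and
  \<open>N\<close> absorbs brackets from the left.\<close>

lemma centralizer_lie_closed:
  assumes N: "graded_subspace K L N" and ideal: "\<And>u v. u \<in> carrier L \<Longrightarrow> v \<in> N \<Longrightarrow> lie L u v \<in> N"
    and y: "y \<in> grade L \<alpha>"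
    and zw: "z \<in> carrier L" "lie L y z \<in> N" "w \<in> carrier L" "lie L y w \<in> N"
  shows "lie L y (lie L z w) \<in> N"
proof -
  note s = graded_subspace_submodule[OF N]
  let ?C = "{z \<in> carrier L. lie L y z \<in> N}"
  note C = graded_subspace_centralizer[OF N y]
  have "lie L z w \<in> ?C" if "z \<in> ?C" "w \<in> ?C" for z w
  proof (rule bilinear_mem_of_homogeneous[OF graded_subspace_submodule[OF C] C C _ that])
    fix \<beta> \<gamma> z w
    assume z: "z \<in> grade L \<beta>" "z \<in> ?C" and w: "w \<in> grade L \<gamma>" "w \<in> ?C"
    have "lie L w y \<in> N" using lie_swap_mem_homogeneous[OF s y w(1)] w by simp
    then have "lie L y (lie L z w) \<in> N"
      using z w by (intro lie_jacobi_mem[OF s y z(1) w(1)]) (auto simp: ideal)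
    then show "lie L z w \<in> ?C" using z w by (auto simp: lie_closed)
  qed
  then show ?thesis using zw by auto
qed

section \<open>The upper central series\<close>

lemma upper_central_subset_carrier: "upper_central L i \<subseteq> carrier L"
  by (cases i) auto

lemma graded_subspace_upper_central: "graded_subspace K L (upper_central L i)"
proof (induction i)
  case 0
  have "x = \<zero>\<^bsub>L\<^esub> \<and> y = \<zero>\<^bsub>L\<^esub>"
    if xy: "x \<in> grade L 0" "y \<in> grade L 1" "x \<oplus>\<^bsub>L\<^esub> y = \<zero>\<^bsub>L\<^esub>" for x y
  proof -
    have c: "x \<in> carrier L" "y \<in> carrier L" using xy grade_carrier by auto
    \<comment> \<open>Both \<open>y\<close> and the sum, which is zero, lie in grade 1; this puts
      \<open>x\<close> into both grades.\<close>
    have "x \<in> grade L 1"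
      using submodule_addD[OF grade_submodule c(1) xy(2)] xy(3)
        submodule.zero_closed[OF grade_submodule] by simp
    then have "x = \<zero>\<^bsub>L\<^esub>" using grade_disjoint xy by blast
    then show ?thesis using xy c by simp
  qed
  moreover have "submodule K {\<zero>\<^bsub>L\<^esub>} L" by (rule submodule_closedI) auto
  ultimately show ?case by (simp add: graded_subspace_def)
next
  case (Suc i)
  let ?Z = "upper_central L i"
  note s = graded_subspace_submodule[OF Suc.IH]
  have "x0 \<in> upper_central L (Suc i) \<and> x1 \<in> upper_central L (Suc i)"
    if x: "x0 \<in> grade L 0" "x1 \<in> grade L 1" "x0 \<oplus>\<^bsub>L\<^esub> x1 \<in> upper_central L (Suc i)" for x0 x1
  proof -
    have c: "x0 \<in> carrier L" "x1 \<in> carrier L" using x grade_carrier by auto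
    \<comment> \<open>For \<open>y\<close> of degree \<alpha> the two brackets have the different
      degrees \<alpha> and \<alpha> + 1, so the gradedness of the previous term of the series
      separates them. A general \<open>y\<close> is then treated through its components.\<close>
    have h: "lie L x0 y \<in> ?Z \<and> lie L x1 y \<in> ?Z" if y: "y \<in> grade L \<alpha>" for y \<alpha>
    proof -
      have "lie L x0 y \<oplus>\<^bsub>L\<^esub> lie L x1 y \<in> ?Z"
        using x c grade_carrier[OF y] by (simp add: lie_add_left)
      moreover have "lie L x0 y \<in> grade L \<alpha>" "lie L x1 y \<in> grade L (\<alpha> + 1)"
        using lie_grade[OF x(1) y, unfolded add_0_left]
          lie_grade[OF x(2) y, unfolded add.commute[of 1]] .
      ultimately show ?thesis using graded_subspace_components[OF Suc.IH] by blast
    qed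
    have "lie L x0 y \<in> ?Z \<and> lie L x1 y \<in> ?Z" if yc: "y \<in> carrier L" for y
    proof -
      obtain y0 y1 where y: "y0 \<in> grade L 0" "y1 \<in> grade L 1" "y = y0 \<oplus>\<^bsub>L\<^esub> y1"
        using homogeneous_components[OF yc] .
      then show ?thesis using h[OF y(1)] h[OF y(2)] submodule.m_closed[OF s] c
        by (simp add: lie_add_right grade_carrier)
    qed
    then show ?thesis using c by simp
  qed
  moreover have "submodule K (upper_central L (Suc i)) L"
    using submodule.zero_closed[OF s] submodule.m_closed[OF s] submodule.smult_closed[OF s]
    by (intro submodule_closedI) (auto simp: lie_zero_left lie_add_left lie_smult_left)
  ultimately show ?case unfolding graded_subspace_def by blast
qed

lemmas submodule_upper_central = graded_subspace_submodule[OF graded_subspace_upper_central]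

lemma upper_central_mono: "upper_central L i \<subseteq> upper_central L (Suc i)"
proof (induction i)
  case 0
  then show ?case by (auto simp: lie_zero_left)
next
  case (Suc i)
  then show ?case by auto
qed

text \<open>For \<open>i = 0\<close> the truncated \<open>i - 1\<close> is again \<open>0\<close>, and both sides are about the zero element.\<close>

lemma lie_upper_central_left:
  assumes "x \<in> upper_central L i" "y \<in> carrier L"
  shows "lie L x y \<in> upper_central L (i - 1)"
  using assms by (cases i) (auto simp: lie_zero_left)

text \<open>The series is defined by brackets with the central element on the left. Skew symmetry
  carries this over to the right, componentwise, as all the subspaces involved are graded.\<close>

lemma lie_upper_central_right:
  assumes "x \<in> upper_central L i" "y \<in> carrier L"
  shows "lie L y x \<in> upper_central L (i - 1)"
  using lie_swap_mem[OF submodule_upper_central graded_subspace_upper_central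
      graded_subspace_carrier lie_upper_central_left] assms by blast

lemma upper_central_ideal:
  assumes "x \<in> upper_central L i" "y \<in> carrier L"
  shows "lie L x y \<in> upper_central L i" "lie L y x \<in> upper_central L i"
  using lie_upper_central_left[OF assms] lie_upper_central_right[OF assms] upper_central_mono[of "i - 1"]
  by (cases i; auto)+

section \<open>Iterated commutators of homogeneous elements\<close>

definition homogeneous :: "'b set" where
  "homogeneous = (\<Union>\<alpha>. grade L \<alpha>)"

lemma homogeneous_carrier: "x \<in> homogeneous \<Longrightarrow> x \<in> carrier L"
  by (auto simp: homogeneous_def grade_carrier)

lemma foldl_lie_closed:
  assumes "x \<in> carrier L" "set as \<subseteq> carrier L"
  shows "foldl (lie L) x as \<in> carrier L"
  using assms by (induction as arbitrary: x) (auto simp: lie_closed)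

lemma foldl_lie_homogeneous:
  assumes "x \<in> homogeneous" "set as \<subseteq> homogeneous"
  shows "foldl (lie L) x as \<in> homogeneous"
  using assms by (induction as arbitrary: x) (auto simp: homogeneous_def dest: lie_grade)

text \<open>Induction on the word from its last letter. Up to signs, [[y,a],u] is a sum of [y,[a,u]]
  and [a,[u,y]]. In both terms the bracket with \<open>a\<close> lowers the index by one and the
  bracket with y lowers it by the number of entries of y. Subtraction is truncated: an index that
  reaches 0 stays there, where only the zero element is left.\<close>

lemma commutator_upper_central:
  assumes "x \<in> homogeneous" "set as \<subseteq> homogeneous" "z \<in> upper_central L j"
  shows "lie L (foldl (lie L) x as) z \<in> upper_central L (j - Suc (length as))"
  using assms(2,3)
proof (induction as arbitrary: j z rule: rev_induct)
  case Nil
  then show ?case using lie_upper_central_right assms homogeneous_carrier by simp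
next
  case (snoc a as)
  let ?y = "foldl (lie L) x as" and ?W = "upper_central L (j - Suc (Suc (length as)))"
  note W = submodule_upper_central
  obtain \<alpha> \<beta> where y: "?y \<in> grade L \<alpha>" and a: "a \<in> grade L \<beta>"
    using foldl_lie_homogeneous[OF assms(1), of as] snoc.prems by (auto simp: homogeneous_def)
  have c: "?y \<in> carrier L" "a \<in> carrier L" using y a grade_carrier by auto
  \<comment> \<open>The same index is split in two ways, according to whether \<open>a\<close> or
    \<open>?y\<close> acts on \<open>u\<close> first.\<close>
  have W1: "?W = upper_central L (j - 1 - Suc (length as))"
    and W2: "?W = upper_central L (j - Suc (length as) - 1)" by simp_all
  have hom: "lie L (lie L ?y a) u \<in> ?W" if u: "u \<in> grade L \<gamma>" "u \<in> upper_central L j" for u \<gamma>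
  proof -
    have 1: "lie L ?y (lie L a u) \<in> ?W"
      unfolding W1 using snoc.IH[OF _ lie_upper_central_right[OF u(2) c(2)]] snoc.prems by simp
    have "lie L u ?y \<in> upper_central L (j - Suc (length as))"
      using snoc u by (intro lie_swap_mem_homogeneous[OF W y u(1)]) simp
    then have 2: "lie L a (lie L u ?y) \<in> ?W"
      unfolding W2 using c(2) by (rule lie_upper_central_right)
    show ?thesis
      by (rule lie_swap_mem_homogeneous[OF W u(1) lie_grade[OF y a] lie_jacobi_mem[OF W u(1) y a 1 2]])
  qed
  obtain z0 z1 where z: "z0 \<in> grade L 0" "z0 \<in> upper_central L j"
    "z1 \<in> grade L 1" "z1 \<in> upper_central L j" "z = z0 \<oplus>\<^bsub>L\<^esub> z1"
    using graded_subspace_obtain[OF graded_subspace_upper_central snoc.prems(2)] .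
  then have "lie L (lie L ?y a) z = lie L (lie L ?y a) z0 \<oplus>\<^bsub>L\<^esub> lie L (lie L ?y a) z1"
    using c by (simp add: lie_add_right lie_closed grade_carrier)
  then show ?case
    using submodule.m_closed[OF W hom[OF z(1,2)] hom[OF z(3,4)]] by simp
qed

end

section \<open>Quotients and commutators\<close>

context lie_superalgebra
begin

lemma quotient_sel [simp]:
  "carrier (quotient_superalgebra L I) = (+>\<^bsub>L\<^esub>) I ` carrier L"
  "zero (quotient_superalgebra L I) = I"
  "add (quotient_superalgebra L I) = (<+>\<^bsub>L\<^esub>)"
  "grade (quotient_superalgebra L I) \<alpha> = (+>\<^bsub>L\<^esub>) I ` grade L \<alpha>"
  by (auto simp: quotient_superalgebra_def A_RCOSETS_def' a_r_coset_def')

section \<open>The quotient by a submodule, and lifting of generation\<close>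

context
  fixes I assumes I: "submodule K I L"
begin

interpretation I: abelian_subgroup I L by (rule abelian_subgroup_submodule[OF I])

lemma coset_add:
  assumes "x \<in> carrier L" "y \<in> carrier L"
  shows "(I +>\<^bsub>L\<^esub> x) <+>\<^bsub>L\<^esub> (I +>\<^bsub>L\<^esub> y) = I +>\<^bsub>L\<^esub> (x \<oplus>\<^bsub>L\<^esub> y)"
  using I.a_rcos_sum[OF assms] .

lemma coset_mem: "x' \<in> I +>\<^bsub>L\<^esub> x \<longleftrightarrow> (\<exists>h\<in>I. x' = h \<oplus>\<^bsub>L\<^esub> x)"
  by (auto simp: a_r_coset_def')

lemma coset_add_left:
  assumes "h \<in> I" "x \<in> carrier L"
  shows "I +>\<^bsub>L\<^esub> (h \<oplus>\<^bsub>L\<^esub> x) = I +>\<^bsub>L\<^esub> x"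
proof -
  have h: "h \<in> carrier L" using assms submodule.subset[OF I] by blast
  then show ?thesis
    using assms by (subst a_r_coset_eq_iff[OF I]) (auto simp: a_minus_def M.a_assoc M.r_neg)
qed

lemma quotient_smult:
  assumes "a \<in> carrier K" "x \<in> carrier L"
  shows "a \<odot>\<^bsub>quotient_superalgebra L I\<^esub> (I +>\<^bsub>L\<^esub> x) = I +>\<^bsub>L\<^esub> (a \<odot>\<^bsub>L\<^esub> x)"
proof -
  have eq: "I +>\<^bsub>L\<^esub> (a \<odot>\<^bsub>L\<^esub> x') = I +>\<^bsub>L\<^esub> (a \<odot>\<^bsub>L\<^esub> x)" if "x' \<in> I +>\<^bsub>L\<^esub> x" for x'
  proof -
    obtain h where h: "h \<in> I" "x' = h \<oplus>\<^bsub>L\<^esub> x" using \<open>x' \<in> _\<close> coset_mem by blast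
    then have "a \<odot>\<^bsub>L\<^esub> x' = a \<odot>\<^bsub>L\<^esub> h \<oplus>\<^bsub>L\<^esub> a \<odot>\<^bsub>L\<^esub> x"
      using assms submodule.subset[OF I] smult_r_distr by blast
    then show ?thesis
      using assms h submodule.smult_closed[OF I] by (simp add: coset_add_left)
  qed
  \<comment> \<open>A union of a constant family equals the constant only over a nonempty index
    set.\<close>
  have "I +>\<^bsub>L\<^esub> x \<noteq> {}" using I.a_rcos_self[OF assms(2)] by blast
  then have "(\<Union>x'\<in>I +>\<^bsub>L\<^esub> x. I +>\<^bsub>L\<^esub> (a \<odot>\<^bsub>L\<^esub> x')) = I +>\<^bsub>L\<^esub> (a \<odot>\<^bsub>L\<^esub> x)"
    using eq by (rule SUP_eq_const)
  then show ?thesis by (simp add: quotient_superalgebra_def)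
qed

lemma vectorspace_quotient: "vectorspace K (quotient_superalgebra L I)"
proof -
  have zero: "I = I +>\<^bsub>L\<^esub> \<zero>\<^bsub>L\<^esub>"
    using submodule.subset[OF I] by (simp add: a_coset_add_zero)
  have neg: "\<exists>u\<in>carrier L. (I +>\<^bsub>L\<^esub> x) <+>\<^bsub>L\<^esub> (I +>\<^bsub>L\<^esub> u) = I" if "x \<in> carrier L" for x
    using that by (intro bexI[of _ "\<ominus>\<^bsub>L\<^esub> x"]) (simp_all add: coset_add M.r_neg zero[symmetric])
  have addz: "(I +>\<^bsub>L\<^esub> x) <+>\<^bsub>L\<^esub> I = I +>\<^bsub>L\<^esub> x" if "x \<in> carrier L" for x
    using coset_add[OF that M.zero_closed] that zero by simp
  let ?Q = "quotient_superalgebra L I"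
  show ?thesis
  proof (rule vs_criteria)
    show "field K" by (rule field_axioms)
    show "\<zero>\<^bsub>?Q\<^esub> \<in> carrier ?Q" using zero by simp
    show "\<forall>v\<in>carrier ?Q. \<exists>u\<in>carrier ?Q. v \<oplus>\<^bsub>?Q\<^esub> u = \<zero>\<^bsub>?Q\<^esub>" using neg by simp
    show "\<forall>v\<in>carrier ?Q. v \<oplus>\<^bsub>?Q\<^esub> \<zero>\<^bsub>?Q\<^esub> = v" using addz by simp
  qed (auto simp: coset_add quotient_smult M.a_ac
      smult_assoc1 smult_l_distr smult_r_distr)
qed

lemma linear_map_quotient: "linear_map K L (quotient_superalgebra L I) ((+>\<^bsub>L\<^esub>) I)"
proof -
  interpret Q: vectorspace K "quotient_superalgebra L I" by (rule vectorspace_quotient)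
  have "(+>\<^bsub>L\<^esub>) I \<in> module_hom K L (quotient_superalgebra L I)"
    by (auto simp: module_hom_def coset_add quotient_smult)
  then show ?thesis
    by (intro linear_map.intro mod_hom.intro mod_hom_axioms.intro vectorspace_axioms
        module_axioms Q.vectorspace_axioms Q.module_axioms)
qed

text \<open>Changing the representatives by \<open>h\<close> and \<open>k\<close> in
  \<open>I\<close> changes [x,y] by [h,k] + [h,y] + [x,k], which lies in the ideal
  \<open>I\<close>.\<close>

lemma quotient_lie:
  assumes ideal: "\<And>h u. h \<in> I \<Longrightarrow> u \<in> carrier L \<Longrightarrow> lie L h u \<in> I \<and> lie L u h \<in> I"
    and xy: "x \<in> carrier L" "y \<in> carrier L"
  shows "lie (quotient_superalgebra L I) (I +>\<^bsub>L\<^esub> x) (I +>\<^bsub>L\<^esub> y) = I +>\<^bsub>L\<^esub> lie L x y"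
proof -
  have eq: "I +>\<^bsub>L\<^esub> lie L x' y' = I +>\<^bsub>L\<^esub> lie L x y"
    if mem: "x' \<in> I +>\<^bsub>L\<^esub> x" "y' \<in> I +>\<^bsub>L\<^esub> y" for x' y'
  proof -
    obtain h where h: "h \<in> I" "x' = h \<oplus>\<^bsub>L\<^esub> x" using mem coset_mem by blast
    obtain k where k: "k \<in> I" "y' = k \<oplus>\<^bsub>L\<^esub> y" using mem coset_mem by blast
    have c: "h \<in> carrier L" "k \<in> carrier L" using h k submodule.subset[OF I] by auto
    have "lie L x' y' = (lie L h k \<oplus>\<^bsub>L\<^esub> lie L h y \<oplus>\<^bsub>L\<^esub> lie L x k) \<oplus>\<^bsub>L\<^esub> lie L x y"
      using xy c by (simp add: h k lie_add_left lie_add_right lie_closed M.a_ac)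
    moreover have "lie L h k \<oplus>\<^bsub>L\<^esub> lie L h y \<oplus>\<^bsub>L\<^esub> lie L x k \<in> I"
      using submodule.m_closed[OF I] ideal h k c xy by simp
    ultimately show ?thesis using xy by (simp add: coset_add_left lie_closed)
  qed
  have "I +>\<^bsub>L\<^esub> x \<noteq> {}" "I +>\<^bsub>L\<^esub> y \<noteq> {}" using I.a_rcos_self xy by blast+
  then have "(\<Union>x'\<in>I +>\<^bsub>L\<^esub> x. \<Union>y'\<in>I +>\<^bsub>L\<^esub> y. I +>\<^bsub>L\<^esub> lie L x' y') = I +>\<^bsub>L\<^esub> lie L x y"
    by (intro SUP_eq_const eq)
  then show ?thesis by (simp add: quotient_superalgebra_def)
qed

text \<open>The image of \<open>M\<close> in the quotient is a subsuperalgebra containing the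
  generators, hence everything; as \<open>M\<close> contains \<open>I\<close>, it is the full
  preimage of its image. This turns generation of the quotient into an induction principle inside
  \<open>L\<close>.\<close>

lemma quotient_generation_lift:
  assumes ideal: "\<And>h u. h \<in> I \<Longrightarrow> u \<in> carrier L \<Longrightarrow> lie L h u \<in> I \<and> lie L u h \<in> I"
    and gen: "generated_subsuperalgebra K (quotient_superalgebra L I) ((+>\<^bsub>L\<^esub>) I ` A)
      = carrier (quotient_superalgebra L I)"
    and M: "graded_subspace K L M" "\<And>x y. x \<in> M \<Longrightarrow> y \<in> M \<Longrightarrow> lie L x y \<in> M"
    and IM: "I \<subseteq> M" and AM: "A \<subseteq> M"
  shows "M = carrier L"
proof
  let ?Q = "quotient_superalgebra L I" and ?p = "(+>\<^bsub>L\<^esub>) I"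
  interpret p: linear_map K L ?Q ?p by (rule linear_map_quotient)
  note s = graded_subspace_submodule[OF M(1)]
  show MC: "M \<subseteq> carrier L" using submodule.subset[OF s] .
  have sub: "submodule K (?p ` M) ?Q" by (rule p.image_submodule[OF s])
  have "lie_subsuperalgebra K (?p ` M) ?Q"
    unfolding lie_subsuperalgebra_def
  proof (intro conjI ballI)
    show "VectorSpace.subspace K (?p ` M) ?Q"
      using sub vectorspace_quotient by (simp add: subspace_def)
    show "?p ` M = (?p ` M \<inter> grade ?Q 0) <+>\<^bsub>?Q\<^esub> (?p ` M \<inter> grade ?Q 1)" (is "_ = ?S")
    proof
      show "?p ` M \<subseteq> ?S"
      proof
        fix X assume "X \<in> ?p ` M"
        then obtain x where x: "x \<in> M" "X = ?p x" by auto
        obtain x0 x1 where d: "x0 \<in> grade L 0" "x0 \<in> M" "x1 \<in> grade L 1" "x1 \<in> M"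
          "x = x0 \<oplus>\<^bsub>L\<^esub> x1"
          using graded_subspace_obtain[OF M(1) x(1)] .
        have "X = ?p x0 \<oplus>\<^bsub>?Q\<^esub> ?p x1"
          unfolding x(2) d(5) using d(1,3)[THEN grade_carrier] by (rule p.f_add)
        moreover have "?p x0 \<in> ?p ` M \<inter> grade ?Q 0" "?p x1 \<in> ?p ` M \<inter> grade ?Q 1"
          using d by auto
        ultimately show "X \<in> ?S" unfolding set_add_def' by blast
      qed
      show "?S \<subseteq> ?p ` M"
        unfolding set_add_def' using submodule.m_closed[OF sub] by blast
    qed
    fix X Y assume "X \<in> ?p ` M" "Y \<in> ?p ` M"
    then obtain x y where xy: "x \<in> M" "y \<in> M" "X = ?p x" "Y = ?p y" by auto
    then have "lie ?Q X Y = ?p (lie L x y)" using quotient_lie[OF ideal] MC by blast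
    then show "lie ?Q X Y \<in> ?p ` M" using M(2) xy by blast
  qed
  then have "carrier ?Q \<subseteq> ?p ` M"
    using AM unfolding gen[symmetric] generated_subsuperalgebra_def by blast
  then have sub: "?p ` carrier L \<subseteq> ?p ` M" by simp
  show "carrier L \<subseteq> M"
  proof
    fix x assume x: "x \<in> carrier L"
    then obtain y where y: "y \<in> M" "?p x = ?p y" using sub by blast
    then have "x \<ominus>\<^bsub>L\<^esub> y \<in> M" using a_r_coset_eq_iff[OF I x] MC IM by blast
    then show "x \<in> M"
      using submodule_addD[OF s x submodule_neg[OF s y(1)]] by (simp add: a_minus_def)
  qed
qed

end

section \<open>Words as linear maps and their joint kernel\<close>

lemma foldl_lie_add:
  assumes "x \<in> carrier L" "y \<in> carrier L" "set as \<subseteq> carrier L"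
  shows "foldl (lie L) (x \<oplus>\<^bsub>L\<^esub> y) as = foldl (lie L) x as \<oplus>\<^bsub>L\<^esub> foldl (lie L) y as"
  using assms by (induction as arbitrary: x y) (auto simp: lie_add_left lie_closed)

lemma foldl_lie_smult:
  assumes "a \<in> carrier K" "x \<in> carrier L" "set as \<subseteq> carrier L"
  shows "foldl (lie L) (a \<odot>\<^bsub>L\<^esub> x) as = a \<odot>\<^bsub>L\<^esub> foldl (lie L) x as"
  using assms by (induction as arbitrary: x) (auto simp: lie_smult_left lie_closed)

text \<open>The shift is the sum of the degrees of the letters. What matters is that it does not
  depend on \<open>x\<close>, so a word sends the two components of an element to different
  grades.\<close>

lemma foldl_lie_grade:
  assumes "set as \<subseteq> homogeneous"
  shows "\<exists>\<delta>. \<forall>\<alpha>. \<forall>x\<in>grade L \<alpha>. foldl (lie L) x as \<in> grade L (\<alpha> + \<delta>)"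
  using assms
proof (induction as)
  case Nil
  show ?case by (intro exI[of _ 0]) (simp only: foldl_Nil add_0_right; blast)
next
  case (Cons a as)
  then obtain \<delta> where d: "\<And>\<alpha> x. x \<in> grade L \<alpha> \<Longrightarrow> foldl (lie L) x as \<in> grade L (\<alpha> + \<delta>)" by auto
  obtain \<beta> where "a \<in> grade L \<beta>" using Cons.prems by (auto simp: homogeneous_def)
  then have "foldl (lie L) x (a # as) \<in> grade L (\<alpha> + (\<beta> + \<delta>))" if "x \<in> grade L \<alpha>" for \<alpha> x
    using d[OF lie_grade[OF that]] unfolding add.assoc by simp
  then show ?case by blast
qed

text \<open>Hypothesis \<open>gen\<close> expresses that \<open>A\<close> generates \<open>L\<close>
  modulo Z_c, without mentioning the quotient. It is applied to the centralizer of a commutator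
  [x,a_1,...] modulo Z_j.\<close>

lemma upper_central_of_commutators_zero_homogeneous:
  assumes A: "A \<subseteq> homogeneous"
    and gen: "\<And>M. graded_subspace K L M \<Longrightarrow> (\<And>x y. x \<in> M \<Longrightarrow> y \<in> M \<Longrightarrow> lie L x y \<in> M) \<Longrightarrow>
      upper_central L c \<subseteq> M \<Longrightarrow> A \<subseteq> M \<Longrightarrow> M = carrier L"
    and x: "x \<in> homogeneous"
    and zero: "\<And>as. length as = c \<Longrightarrow> set as \<subseteq> A \<Longrightarrow> foldl (lie L) x as = \<zero>\<^bsub>L\<^esub>"
  shows "x \<in> upper_central L c"
proof -
  \<comment> \<open>The index \<open>j\<close> grows as the word shrinks: \<open>j = 0\<close> is
    the hypothesis on words of length \<open>c\<close>, and \<open>j = c\<close> with the empty word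
    is the claim for \<open>x\<close> itself.\<close>
  have "foldl (lie L) x as \<in> upper_central L j" if "j \<le> c" "length as = c - j" "set as \<subseteq> A" for j as
    using that
  proof (induction j arbitrary: as)
    case 0
    then show ?case using zero by simp
  next
    case (Suc j)
    let ?y = "foldl (lie L) x as" and ?Z = "upper_central L j"
    let ?C = "{z \<in> carrier L. lie L ?y z \<in> ?Z}"
    have as: "set as \<subseteq> homogeneous" using Suc.prems A by auto
    then obtain \<alpha> where y: "?y \<in> grade L \<alpha>"
      using foldl_lie_homogeneous[OF x] by (auto simp: homogeneous_def)
    note Z = graded_subspace_upper_central[of j]
    have "?C = carrier L"
    proof (rule gen)
      show "graded_subspace K L ?C" by (rule graded_subspace_centralizer[OF Z y])
      show "lie L z w \<in> ?C" if "z \<in> ?C" "w \<in> ?C" for z w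
        using that centralizer_lie_closed[OF Z upper_central_ideal(2) y] by (simp add: lie_closed)
      \<comment> \<open>The word has \<open>c - Suc j\<close> letters, so \<open>?y\<close> has
        \<open>c - j\<close> entries and maps Z_c exactly into Z_j.\<close>
      have "c - Suc (length as) = j" using Suc.prems by simp
      then show "upper_central L c \<subseteq> ?C"
        using commutator_upper_central[OF x as, of _ c] upper_central_subset_carrier by auto
      show "A \<subseteq> ?C"
      proof
        fix a assume a: "a \<in> A"
        have "foldl (lie L) x (as @ [a]) \<in> ?Z"
          using Suc.prems a by (intro Suc.IH) auto
        then show "a \<in> ?C" using a A homogeneous_carrier by auto
      qed
    qed
    then show ?case using grade_carrier[OF y] by auto
  qed
  from this[of c "[]"] show ?thesis by simp
qed

lemma upper_central_of_commutators_zero: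
  assumes A: "A \<subseteq> homogeneous"
    and gen: "\<And>M. graded_subspace K L M \<Longrightarrow> (\<And>x y. x \<in> M \<Longrightarrow> y \<in> M \<Longrightarrow> lie L x y \<in> M) \<Longrightarrow>
      upper_central L c \<subseteq> M \<Longrightarrow> A \<subseteq> M \<Longrightarrow> M = carrier L"
    and x: "x \<in> carrier L"
    and zero: "\<And>as. length as = c \<Longrightarrow> set as \<subseteq> A \<Longrightarrow> foldl (lie L) x as = \<zero>\<^bsub>L\<^esub>"
  shows "x \<in> upper_central L c"
proof -
  obtain x0 x1 where d: "x0 \<in> grade L 0" "x1 \<in> grade L 1" "x = x0 \<oplus>\<^bsub>L\<^esub> x1"
    using homogeneous_components[OF x] .
  have z: "foldl (lie L) x0 as = \<zero>\<^bsub>L\<^esub> \<and> foldl (lie L) x1 as = \<zero>\<^bsub>L\<^esub>"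
    if as: "length as = c" "set as \<subseteq> A" for as
  proof -
    obtain \<delta> where \<delta>: "\<And>\<alpha> x. x \<in> grade L \<alpha> \<Longrightarrow> foldl (lie L) x as \<in> grade L (\<alpha> + \<delta>)"
      using foldl_lie_grade[of as] as A by blast
    have "set as \<subseteq> carrier L" using as A homogeneous_carrier by blast
    \<comment> \<open>Vanishing of the sum is read as membership in the graded subspace
      \<open>upper_central L 0\<close>, so that the two terms, being of different degrees, vanish
      separately.\<close>
    then have "foldl (lie L) x0 as \<oplus>\<^bsub>L\<^esub> foldl (lie L) x1 as \<in> upper_central L 0"
      using zero[OF as] d by (simp add: foldl_lie_add grade_carrier)
    then show ?thesis
      using graded_subspace_components[OF graded_subspace_upper_central[of 0]
          \<delta>[OF d(1), unfolded add_0_left] \<delta>[OF d(2), unfolded add.commute[of 1]]] by auto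
  qed
  have "x0 \<in> homogeneous" "x1 \<in> homogeneous" using d by (auto simp: homogeneous_def)
  then have "x0 \<in> upper_central L c" "x1 \<in> upper_central L c"
    using upper_central_of_commutators_zero_homogeneous[OF A gen] z by blast+
  then show ?thesis using d submodule.m_closed[OF submodule_upper_central] by simp
qed

section \<open>Commutators span the terms of the lower central series\<close>

lemma commutators_subset_carrier: "commutators L t \<subseteq> carrier L"
  by (auto simp: commutators_def foldl_lie_closed)

text \<open>The last letter is split off the word. The recursion starts at 1, since
  \<open>commutators L 0\<close> is empty.\<close>

lemma commutators_Suc:
  assumes "t \<ge> 1"
  shows "commutators L (Suc t) = {lie L x y | x y. x \<in> commutators L t \<and> y \<in> carrier L}" (is "_ = ?R")
proof
  show "commutators L (Suc t) \<subseteq> ?R"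
  proof
    fix z assume "z \<in> commutators L (Suc t)"
    then obtain x xs where z: "z = foldl (lie L) x xs" "x \<in> carrier L" "set xs \<subseteq> carrier L"
      "length xs = t"
      by (auto simp: commutators_def)
    then obtain ys y where "xs = ys @ [y]" using assms by (cases xs rule: rev_cases) auto
    with z show "z \<in> ?R" by (force simp: commutators_def)
  qed
  show "?R \<subseteq> commutators L (Suc t)"
  proof
    fix z assume "z \<in> ?R"
    then obtain x xs y where "z = lie L (foldl (lie L) x xs) y" "x \<in> carrier L"
      "set xs \<subseteq> carrier L" "Suc (length xs) = t" "y \<in> carrier L"
      by (auto simp: commutators_def)
    then show "z \<in> commutators L (Suc t)"
      unfolding commutators_def by (intro CollectI exI[of _ x] exI[of _ "xs @ [y]"]) simp
  qed
qed

text \<open>The recursion brackets arbitrary elements of the previous span, not just commutators.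
  For fixed \<open>y\<close>, however, the \<open>x\<close> with [x,y] in the new span form a
  submodule, and it contains the shorter commutators.\<close>

lemma lower_central_eq_span: "lower_central K L (Suc k) = span (commutators L (Suc k))"
proof (induction k)
  case 0
  have "commutators L (Suc 0) = carrier L" by (auto simp: commutators_def)
  moreover have "span (carrier L) = carrier L"
    using span_is_subset2[of "carrier L"] in_own_span[of "carrier L"] by blast
  ultimately show ?case by simp
next
  case (Suc k)
  let ?C = "commutators L (Suc k)" and ?C' = "commutators L (Suc (Suc k))"
  let ?G = "{lie L x y | x y. x \<in> span ?C \<and> y \<in> carrier L}"
  note C = commutators_subset_carrier
  note S = span_is_submodule[OF C]
  have spC: "span ?C \<subseteq> carrier L" using span_is_subset2[OF C] .
  have G: "?G \<subseteq> carrier L" using spC lie_closed by blast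
  have "?C' \<subseteq> ?G"
    unfolding commutators_Suc[of "Suc k", simplified] using in_own_span[OF C] by blast
  then have "span ?C' \<subseteq> span ?G" by (rule span_is_monotone)
  moreover have "?G \<subseteq> span ?C'"
  proof -
    have "lie L x y \<in> span ?C'" if x: "x \<in> span ?C" and y: "y \<in> carrier L" for x y
    proof -
      let ?U = "{x \<in> carrier L. lie L x y \<in> span ?C'}"
      have "submodule K ?U L"
        using y submodule.zero_closed[OF S] submodule.m_closed[OF S] submodule.smult_closed[OF S]
        by (intro submodule_closedI) (simp_all add: lie_zero_left lie_add_left lie_smult_left subset_iff)
      moreover have "?C \<subseteq> ?U"
      proof
        fix u assume u: "u \<in> ?C"
        have "lie L u y \<in> ?C'"
          using u y unfolding commutators_Suc[of "Suc k", simplified] by blast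
        then show "u \<in> ?U" using u C in_own_span[OF C] by blast
      qed
      ultimately show ?thesis using span_is_subset x by blast
    qed
    then show ?thesis by blast
  qed
  then have "span ?G \<subseteq> span ?C'" using S by (rule span_is_subset)
  ultimately show ?case using Suc by simp
qed

end

section \<open>Lifting the generators and the dimension bound\<close>

lemma (in lie_superalgebra) quotient_generators_lift:
  assumes "generated_by K (quotient_superalgebra L I) m n"
  obtains A where "A \<subseteq> homogeneous" "finite A" "card A \<le> m + n"
    "generated_subsuperalgebra K (quotient_superalgebra L I) ((+>\<^bsub>L\<^esub>) I ` A)
      = carrier (quotient_superalgebra L I)"
proof -
  let ?p = "(+>\<^bsub>L\<^esub>) I"
  obtain xs ys where xy: "length xs = m" "length ys = n"
    "set xs \<subseteq> grade (quotient_superalgebra L I) 0"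
    "set ys \<subseteq> grade (quotient_superalgebra L I) 1"
    "generated_subsuperalgebra K (quotient_superalgebra L I) (set xs \<union> set ys)
      = carrier (quotient_superalgebra L I)"
    using assms unfolding generated_by_def by (elim exE conjE)
  \<comment> \<open>One homogeneous preimage is chosen for each distinct coset. Injectivity on
    \<open>A0\<close> bounds its size by the length of \<open>xs\<close>, and repeated generators
    only make it smaller.\<close>
  obtain A0 where A0: "A0 \<subseteq> grade L 0" "inj_on ?p A0" "set xs = ?p ` A0"
    using xy(3) unfolding quotient_sel(4) subset_image_inj by (elim exE conjE)
  obtain A1 where A1: "A1 \<subseteq> grade L 1" "inj_on ?p A1" "set ys = ?p ` A1"
    using xy(4) unfolding quotient_sel(4) subset_image_inj by (elim exE conjE)
  have fin: "finite A0" "finite A1"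
    using A0 A1 finite_imageD finite_set by metis+
  have "card A0 \<le> m" "card A1 \<le> n"
    using card_length[of xs] card_length[of ys] A0 A1 xy(1,2) by (simp_all add: card_image)
  then have "card (A0 \<union> A1) \<le> m + n" using card_Un_le[of A0 A1] by linarith
  moreover have "?p ` (A0 \<union> A1) = set xs \<union> set ys"
    unfolding A0(3) A1(3) by (rule image_Un)
  moreover have "A0 \<union> A1 \<subseteq> homogeneous" using A0(1) A1(1) unfolding homogeneous_def by blast
  ultimately show thesis using that[of "A0 \<union> A1"] fin xy(5) by simp
qed

lemma (in lie_superalgebra) dim_quotient_upper_central_le:
  assumes fin: "vectorspace.fin_dim K (vs (lower_central K L (c + 1)))"
    and gen: "generated_by K (quotient_superalgebra L (upper_central L c)) m n"
  shows "vectorspace.fin_dim K (quotient_superalgebra L (upper_central L c)) \<and>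
    vectorspace.dim K (quotient_superalgebra L (upper_central L c))
      \<le> (m + n) ^ c * vectorspace.dim K (vs (lower_central K L (c + 1)))"
proof -
  let ?Z = "upper_central L c" and ?W = "vs (lower_central K L (c + 1))"
  let ?Q = "quotient_superalgebra L ?Z" and ?p = "(+>\<^bsub>L\<^esub>) ?Z"
  have Z: "submodule K ?Z L" by (rule submodule_upper_central)
  have ideal: "lie L h u \<in> ?Z \<and> lie L u h \<in> ?Z" if "h \<in> ?Z" "u \<in> carrier L" for h u
    using upper_central_ideal[OF that] by simp
  obtain A where A: "A \<subseteq> homogeneous" "finite A" "card A \<le> m + n"
    and genA: "generated_subsuperalgebra K ?Q (?p ` A) = carrier ?Q"
    using quotient_generators_lift[OF gen] .
  have AC: "A \<subseteq> carrier L" using A homogeneous_carrier by blast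
  interpret Q: vectorspace K ?Q by (rule vectorspace_quotient[OF Z])
  interpret p: linear_map K L ?Q ?p by (rule linear_map_quotient[OF Z])
  have lc: "lower_central K L (c + 1) = span (commutators L (Suc c))"
    using lower_central_eq_span[of c] by simp
  have W: "vectorspace K ?W"
    unfolding lc by (intro subspace_is_vs span_is_subspace commutators_subset_carrier)
  define T where "T = {as. set as \<subseteq> A \<and> length as = c}"
  define F where "F = (\<lambda>as x. foldl (lie L) x as) ` T"
  have T: "finite T" "card T = card A ^ c"
    unfolding T_def using A(2) finite_lists_length_eq card_lists_length_eq by blast+
  \<comment> \<open>Different words may induce the same map, so only an inequality holds
    here.\<close>
  have "card F \<le> card T" unfolding F_def using T(1) by (rule card_image_le)
  also have "\<dots> \<le> (m + n) ^ c" using T A(3) by (simp add: power_mono)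
  finally have cardF: "card F \<le> (m + n) ^ c" .
  have hom: "F \<subseteq> module_hom K L ?W"
  proof
    fix f assume "f \<in> F"
    then obtain as where f: "f = (\<lambda>x. foldl (lie L) x as)" and as: "set as \<subseteq> A" "length as = c"
      unfolding F_def T_def by blast
    have asC: "set as \<subseteq> carrier L" using as AC by blast
    have "f x \<in> commutators L (Suc c)" if "x \<in> carrier L" for x
      using that asC as(2) unfolding commutators_def f by blast
    then have "f \<in> carrier L \<rightarrow> span (commutators L (Suc c))"
      using in_own_span[OF commutators_subset_carrier] by blast
    then show "f \<in> module_hom K L ?W"
      unfolding lc module_hom_def using asC by (simp add: f foldl_lie_add foldl_lie_smult)
  qed
  have finF: "finite F" unfolding F_def using T(1) by simp
  \<comment> \<open>Modulo the joint kernel of the words, \<open>L\<close> is spanned by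
    \<open>B\<close>. Once that kernel is shown to lie in Z_c, the cosets of \<open>B\<close> span
    the quotient, whose dimension is therefore at most \<open>card B\<close>.\<close>
  obtain B where B: "finite B" "B \<subseteq> carrier L" "card B \<le> card F * vectorspace.dim K ?W"
    and span: "\<And>v. v \<in> carrier L \<Longrightarrow> \<exists>s\<in>span B. \<forall>f\<in>F. f (v \<ominus>\<^bsub>L\<^esub> s) = \<zero>\<^bsub>L\<^esub>"
    using carrier_eq_span_plus_joint_ker[OF W fin finF hom] by auto
  have pB: "?p ` B \<subseteq> carrier ?Q" using B(2) by auto
  have "carrier ?Q \<subseteq> Q.span (?p ` B)"
  proof
    fix X assume "X \<in> carrier ?Q"
    then obtain v where v: "v \<in> carrier L" "X = ?p v" by auto
    obtain s where s: "s \<in> span B" "\<And>f. f \<in> F \<Longrightarrow> f (v \<ominus>\<^bsub>L\<^esub> s) = \<zero>\<^bsub>L\<^esub>"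
      using span[OF v(1)] by blast
    have sC: "s \<in> carrier L" using s(1) span_closed[OF B(2)] by blast
    have "v \<ominus>\<^bsub>L\<^esub> s \<in> ?Z"
    proof (rule upper_central_of_commutators_zero[OF A(1)])
      show "M = carrier L" if "graded_subspace K L M"
        "\<And>x y. x \<in> M \<Longrightarrow> y \<in> M \<Longrightarrow> lie L x y \<in> M" "?Z \<subseteq> M" "A \<subseteq> M" for M
        using quotient_generation_lift[OF Z ideal genA that] .
      show "v \<ominus>\<^bsub>L\<^esub> s \<in> carrier L" using v(1) sC by (rule M.minus_closed)
      show "foldl (lie L) (v \<ominus>\<^bsub>L\<^esub> s) as = \<zero>\<^bsub>L\<^esub>" if "length as = c" "set as \<subseteq> A" for as
        using s(2)[of "\<lambda>x. foldl (lie L) x as"] that unfolding F_def T_def by blast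
    qed
    then have "X = ?p s" using a_r_coset_eq_iff[OF Z v(1) sC] v(2) by simp
    moreover have "?p ` span B \<subseteq> Q.span (?p ` B)" by (rule p.image_span_subset[OF B(2)])
    ultimately show "X \<in> Q.span (?p ` B)" using s(1) by blast
  qed
  then have genB: "Q.gen_set (?p ` B)" using Q.span_is_subset2[OF pB] by blast
  have fB: "finite (?p ` B)" using B(1) by simp
  have "Q.dim \<le> card (?p ` B)" using Q.gen_ge_dim[OF fB pB genB] .
  also have "\<dots> \<le> card B" using B(1) by (rule card_image_le)
  also have "\<dots> \<le> (m + n) ^ c * vectorspace.dim K ?W"
    using B(3) cardF mult_le_mono1 order_trans by blast
  finally have "Q.dim \<le> (m + n) ^ c * vectorspace.dim K ?W" .
  moreover have "Q.fin_dim" unfolding Q.fin_dim_def using fB pB genB by blast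
  ultimately show ?thesis by blast
qed

theorem theorem5p4:
  fixes K :: "('a, 'k) ring_scheme" and L :: "('a, 'b, 'l) superalgebra_scheme" and c :: nat
  assumes "lie_superalgebra K L"
    and char_not_2: "[(2::nat)] \<cdot>\<^bsub>K\<^esub> \<one>\<^bsub>K\<^esub> \<noteq> \<zero>\<^bsub>K\<^esub>"
    and char_not_3: "[(3::nat)] \<cdot>\<^bsub>K\<^esub> \<one>\<^bsub>K\<^esub> \<noteq> \<zero>\<^bsub>K\<^esub>"
    and "c \<ge> 1"
    and "finite (commutators L (c + 1))"
  shows "vectorspace.fin_dim K (L\<lparr>carrier := lower_central K L (c + 1)\<rparr>) \<and>
    (\<forall>m n. generated_by K (quotient_superalgebra L (upper_central L c)) m n \<longrightarrow>
       vectorspace.fin_dim K (quotient_superalgebra L (upper_central L c)) \<and>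
       vectorspace.dim K (quotient_superalgebra L (upper_central L c))
         \<le> (m + n) ^ c * vectorspace.dim K (L\<lparr>carrier := lower_central K L (c + 1)\<rparr>))"
proof -
  interpret lie_superalgebra K L by (rule assms(1))
  \<comment> \<open>The finite set of commutators of length \<open>c + 1\<close> spans this
    space.\<close>
  have "vectorspace.fin_dim K (vs (lower_central K L (c + 1)))"
    using fin_dim_span[OF _ commutators_subset_carrier] assms(5) lower_central_eq_span[of c] by simp
  then show ?thesis using dim_quotient_upper_central_le by blast
qed

end
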